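(* Let $N\geq 2$, $L>0$ and participation probabilities $p_1,\dots,p_N\in(0,1]$ be given, with $p_{\min}=\min_ip_i$. There is a constant $c>0$ depending only on $L$ and $N$ such that, for any time horizon $T\ge1$ and dimension $d$ with $T\le\frac{d-1}2$, there exist $N$ local objectives $F_i:\mathbb{R}^d\to\mathbb{R}$, each $L$-smooth ($\|\nabla F_i(u)-\nabla F_i(v)\|\le L\|u-v\|$ for all $u,v$), for which the iterates $w^{(1)},\dots,w^{(T)}$ of any first-order black-box federated optimization procedure which leverages both fresh and stale updates (as defined in the context) satisfy $$\min_{1\le t\le T}\mathbb{E}\|\nabla F(w^{(t)})\|^2\ge c\,\frac{F(w^{(1)})-F^*}{p_{\min}^3T^3+1},$$ where $F=\frac1N\sum_{i=1}^NF_i$, $F^*=\min_wF(w)$, and the expectation is over client participation.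
   Context: There are $N$ clients. In each round $t=1,2,\dots$ client $i$ participates with probability $p_i$, independently of previous rounds and of other clients; $\mathcal{S}^{(t)}$ is the set of participating clients. First-order black-box federated procedure with fresh and stale updates: the server maintains a linear subspace $M^{(t)}\subseteq\mathbb{R}^d$ of known vectors, with $M^{(1)}=\{0\}$, $w^{(1)}=0$, and $w^{(t)}\in M^{(t)}$ for every $t$. In round $t$ each participating client $i\in\mathcal{S}^{(t)}$ performs $K\ge1$ local steps: it chooses points $x_i^{(t,0)},\dots,x_i^{(t,K-1)}$ and computes the gradients $\nabla F_i(x_i^{(t,k)})$, where $x_i^{(t,k)}$ lies in the linear span of $M^{(t)}$ and of $\nabla F_i(x_i^{(t,0)}),\dots,\nabla F_i(x_i^{(t,k-1)})$. Then $M^{(t+1)}$ is the linear span of $M^{(t)}$ and of all gradients computed in round $t$ by participating clients. Thus the server may use both fresh information from the current participants and any stored (stale) information from previous rounds, but gets no new information from non-participating clients. *)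

theory Defs
  imports "HOL-Analysis.Analysis" "HOL-Probability.Probability"
begin

text \<open>
  The constant in the theorem must not depend on the dimension \<open>d\<close>, so \<open>d\<close> has to be quantified
  inside the statement and cannot be a type. All the spaces \<open>\<real>\<^sup>d\<close> are therefore realised as the
  subspaces \<open>Rn d\<close> of one real inner product space: the finitely supported real sequences with
  the dot product. On \<open>Rn d\<close> the inner product and norm are the standard Euclidean ones
  (lemmas \<open>inner_Rn\<close> and \<open>norm_Rn\<close>).
\<close>

typedef fvec = "{f :: nat \<Rightarrow> real. finite {i. f i \<noteq> 0}}"
  morphisms coord Abs_fvec
  by (rule exI[of _ "\<lambda>_. 0"]) simp

setup_lifting type_definition_fvec

lemma finite_coord [simp]: "finite {i. coord x i \<noteq> 0}"
  using coord by auto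

lemma fvec_eqI: "(\<And>i. coord x i = coord y i) \<Longrightarrow> x = y"
  by (simp add: coord_inject[symmetric] fun_eq_iff)

instantiation fvec :: real_vector
begin

lift_definition zero_fvec :: fvec is "\<lambda>_. 0" by simp

lift_definition plus_fvec :: "fvec \<Rightarrow> fvec \<Rightarrow> fvec" is "\<lambda>x y i. x i + y i"
  subgoal for x y by (rule finite_subset[of _ "{i. x i \<noteq> 0} \<union> {i. y i \<noteq> 0}"]) auto
  done

lift_definition uminus_fvec :: "fvec \<Rightarrow> fvec" is "\<lambda>x i. - x i" by simp

lift_definition minus_fvec :: "fvec \<Rightarrow> fvec \<Rightarrow> fvec" is "\<lambda>x y i. x i - y i"
  subgoal for x y by (rule finite_subset[of _ "{i. x i \<noteq> 0} \<union> {i. y i \<noteq> 0}"]) auto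
  done

lift_definition scaleR_fvec :: "real \<Rightarrow> fvec \<Rightarrow> fvec" is "\<lambda>c x i. c * x i"
  subgoal for c x by (rule finite_subset[of _ "{i. x i \<noteq> 0}"]) auto
  done

instance
  by standard (transfer; simp add: fun_eq_iff algebra_simps)+

end

lemma coord_simps [simp]:
  "coord 0 i = 0"
  "coord (x + y) i = coord x i + coord y i"
  "coord (- x) i = - coord x i"
  "coord (x - y) i = coord x i - coord y i"
  "coord (c *\<^sub>R x) i = c * coord x i"
  by (transfer; simp)+

instantiation fvec :: real_inner
begin

definition inner_fvec :: "fvec \<Rightarrow> fvec \<Rightarrow> real"
  where "inner_fvec x y = (\<Sum>i | coord x i \<noteq> 0. coord x i * coord y i)"

definition norm_fvec :: "fvec \<Rightarrow> real"
  where "norm_fvec x = sqrt (inner x x)"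

definition sgn_fvec :: "fvec \<Rightarrow> fvec"
  where "sgn_fvec x = x /\<^sub>R norm x"

definition dist_fvec :: "fvec \<Rightarrow> fvec \<Rightarrow> real"
  where "dist_fvec x y = norm (x - y)"

definition uniformity_fvec :: "(fvec \<times> fvec) filter"
  where "uniformity_fvec = (INF e\<in>{0<..}. principal {(x, y). dist x y < e})"

definition open_fvec :: "fvec set \<Rightarrow> bool"
  where "open_fvec U \<longleftrightarrow> (\<forall>x\<in>U. \<forall>\<^sub>F (x', y) in uniformity. x' = x \<longrightarrow> y \<in> U)"

instance
proof
  have sup: "inner u v = (\<Sum>i\<in>A. coord u i * coord v i)"
    if "finite A" "{i. coord u i \<noteq> 0} \<subseteq> A" for u v :: fvec and A
    unfolding inner_fvec_def using that by (intro sum.mono_neutral_left) auto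
  fix x y z :: fvec and r :: real and U :: "fvec set"
  let ?A = "{i. coord x i \<noteq> 0} \<union> {i. coord y i \<noteq> 0}"
  show "dist x y = norm (x - y)" by (rule dist_fvec_def)
  show "sgn x = inverse (norm x) *\<^sub>R x" by (rule sgn_fvec_def)
  show "uniformity = (INF e\<in>{0<..}. principal {(x :: fvec, y). dist x y < e})"
    by (rule uniformity_fvec_def)
  show "open U \<longleftrightarrow> (\<forall>x\<in>U. \<forall>\<^sub>F (x', y) in uniformity. x' = x \<longrightarrow> y \<in> U)"
    by (rule open_fvec_def)
  show "norm x = sqrt (inner x x)" by (rule norm_fvec_def)
  have "inner x y = (\<Sum>i\<in>?A. coord x i * coord y i)" by (rule sup) auto
  moreover have "inner y x = (\<Sum>i\<in>?A. coord y i * coord x i)" by (rule sup) auto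
  ultimately show "inner x y = inner y x" by (simp add: mult.commute)
  have "inner (x + y) z = (\<Sum>i\<in>?A. coord (x + y) i * coord z i)" by (rule sup) auto
  moreover have "inner x z = (\<Sum>i\<in>?A. coord x i * coord z i)" by (rule sup) auto
  moreover have "inner y z = (\<Sum>i\<in>?A. coord y i * coord z i)" by (rule sup) auto
  ultimately show "inner (x + y) z = inner x z + inner y z"
    by (simp add: sum.distrib distrib_right)
  have "inner (r *\<^sub>R x) y = (\<Sum>i | coord x i \<noteq> 0. coord (r *\<^sub>R x) i * coord y i)"
    by (rule sup) auto
  then show "inner (r *\<^sub>R x) y = r * inner x y"
    by (simp add: inner_fvec_def sum_distrib_left mult.assoc)
  show "0 \<le> inner x x" by (simp add: inner_fvec_def sum_nonneg)
  have "inner x x = 0 \<longleftrightarrow> (\<forall>i\<in>{i. coord x i \<noteq> 0}. coord x i * coord x i = 0)"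
    unfolding inner_fvec_def by (rule sum_nonneg_eq_0_iff) auto
  then show "inner x x = 0 \<longleftrightarrow> x = 0" by (auto intro: fvec_eqI)
qed

end

definition Rn :: "nat \<Rightarrow> fvec set"
  where "Rn d = {x. \<forall>i\<ge>d. coord x i = 0}"

lemma subspace_Rn: "subspace (Rn d)"
  by (auto simp: subspace_def Rn_def)

lemma inner_Rn:
  assumes "x \<in> Rn d"
  shows "x \<bullet> y = (\<Sum>i<d. coord x i * coord y i)"
  unfolding inner_fvec_def
  by (rule sum.mono_neutral_left) (use assms in \<open>auto simp: Rn_def not_le[symmetric]\<close>)

lemma norm_Rn: "x \<in> Rn d \<Longrightarrow> norm x = sqrt (\<Sum>i<d. (coord x i)\<^sup>2)"
  by (simp add: norm_eq_sqrt_inner inner_Rn power2_eq_square)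

lemma coord_Rn_surj: "\<exists>x\<in>Rn d. \<forall>i<d. coord x i = f i"
proof (intro bexI)
  have *: "coord (Abs_fvec (\<lambda>i. if i < d then f i else 0)) = (\<lambda>i. if i < d then f i else 0)"
    by (rule Abs_fvec_inverse) (auto intro: finite_subset[of _ "{..<d}"])
  show "\<forall>i<d. coord (Abs_fvec (\<lambda>i. if i < d then f i else 0)) i = f i"
    and "Abs_fvec (\<lambda>i. if i < d then f i else 0) \<in> Rn d"
    by (simp_all add: * Rn_def)
qed

text \<open>
  A function \<open>\<real>\<^sup>d \<rightarrow> \<real>\<close> is a function on \<^typ>\<open>fvec\<close> of which only the values on \<open>Rn d\<close> are used.
\<close>

definition has_gradient :: "nat \<Rightarrow> (fvec \<Rightarrow> real) \<Rightarrow> fvec \<Rightarrow> fvec \<Rightarrow> bool"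
  where "has_gradient d f x g \<longleftrightarrow>
    g \<in> Rn d \<and> (f has_derivative (\<lambda>h. g \<bullet> h)) (at x within Rn d)"

lemma has_gradient_unique:
  assumes "x \<in> Rn d" "has_gradient d f x g" "has_gradient d f x g'"
  shows "g = g'"
proof -
  let ?v = "g - g'"
  have v: "?v \<in> Rn d"
    using assms by (auto simp: has_gradient_def intro: subspace_diff[OF subspace_Rn])
  have line: "((\<lambda>t. f (x + t *\<^sub>R ?v)) has_real_derivative g'' \<bullet> ?v) (at 0)"
    if "has_gradient d f x g''" for g''
  proof -
    have "((\<lambda>t. x + t *\<^sub>R ?v) has_derivative (\<lambda>t. t *\<^sub>R ?v)) (at (0 :: real))"
      by (auto intro!: derivative_eq_intros)
    moreover have "range (\<lambda>t. x + t *\<^sub>R ?v) \<subseteq> Rn d"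
      using v assms(1) by (auto intro!: subspace_add subspace_scale subspace_Rn)
    then have "(f has_derivative (\<lambda>h. g'' \<bullet> h)) (at (x + 0 *\<^sub>R ?v) within range (\<lambda>t. x + t *\<^sub>R ?v))"
      using that by (auto simp: has_gradient_def intro: has_derivative_subset)
    ultimately have "((\<lambda>t. f (x + t *\<^sub>R ?v)) has_derivative (\<lambda>t. g'' \<bullet> (t *\<^sub>R ?v))) (at 0)"
      by (rule has_derivative_in_compose)
    then show ?thesis
      by (rule has_derivative_imp_has_field_derivative) simp
  qed
  have "g \<bullet> ?v = g' \<bullet> ?v"
    using DERIV_unique line[OF assms(2)] line[OF assms(3)] by blast
  then have "?v \<bullet> ?v = 0" by (simp add: inner_diff_left)
  then show ?thesis by simp
qed

definition grad :: "nat \<Rightarrow> (fvec \<Rightarrow> real) \<Rightarrow> fvec \<Rightarrow> fvec"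
  where "grad d f x = (THE g. has_gradient d f x g)"

definition smooth_fun :: "nat \<Rightarrow> real \<Rightarrow> (fvec \<Rightarrow> real) \<Rightarrow> bool"
  where "smooth_fun d L f \<longleftrightarrow>
    (\<forall>x\<in>Rn d. \<exists>g. has_gradient d f x g) \<and>
    (\<forall>u\<in>Rn d. \<forall>v\<in>Rn d. norm (grad d f u - grad d f v) \<le> L * norm (u - v))"

definition global_obj :: "nat \<Rightarrow> (nat \<Rightarrow> fvec \<Rightarrow> real) \<Rightarrow> fvec \<Rightarrow> real"
  where "global_obj N F w = (1 / real N) * (\<Sum>i<N. F i w)"

definition is_minimizer :: "nat \<Rightarrow> (fvec \<Rightarrow> real) \<Rightarrow> fvec \<Rightarrow> bool"
  where "is_minimizer d f w \<longleftrightarrow> w \<in> Rn d \<and> (\<forall>v\<in>Rn d. f w \<le> f v)"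

text \<open>
  Clients are \<open>0, \<dots>, N - 1\<close> and rounds are \<open>1, 2, \<dots>\<close>. A realisation of the participation is a
  sequence \<open>S\<close>, where \<open>S t\<close> is the set of clients participating in round \<open>t\<close>.
\<close>

definition fed_run ::
  "nat \<Rightarrow> nat \<Rightarrow> (nat \<Rightarrow> fvec \<Rightarrow> real) \<Rightarrow> (nat \<Rightarrow> nat set) \<Rightarrow>
   (nat \<Rightarrow> fvec set) \<Rightarrow> (nat \<Rightarrow> fvec) \<Rightarrow> (nat \<Rightarrow> nat \<Rightarrow> nat \<Rightarrow> fvec) \<Rightarrow> bool"
  where "fed_run d K F S M w x \<longleftrightarrow>
    M 1 = {0} \<and> w 1 = 0 \<and>
    (\<forall>t\<ge>1. w t \<in> M t) \<and>
    (\<forall>t\<ge>1. \<forall>i\<in>S t. \<forall>k<K.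
       x t i k \<in> span (M t \<union> {grad d (F i) (x t i j) | j. j < k})) \<and>
    (\<forall>t\<ge>1. M (Suc t) = span (M t \<union> {grad d (F i) (x t i k) | i k. i \<in> S t \<and> k < K}))"

text \<open>
  A procedure determines a run for every realisation of the participation. That its choices in
  round \<open>t\<close> only depend on the participation up to round \<open>t\<close> is not required: the lower bound is
  claimed for the larger class.
\<close>

definition fed_procedure ::
  "nat \<Rightarrow> nat \<Rightarrow> nat \<Rightarrow> (nat \<Rightarrow> fvec \<Rightarrow> real) \<Rightarrow>
   ((nat \<Rightarrow> nat set) \<Rightarrow> nat \<Rightarrow> fvec set) \<Rightarrow>
   ((nat \<Rightarrow> nat set) \<Rightarrow> nat \<Rightarrow> fvec) \<Rightarrow>
   ((nat \<Rightarrow> nat set) \<Rightarrow> nat \<Rightarrow> nat \<Rightarrow> nat \<Rightarrow> fvec) \<Rightarrow> bool"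
  where "fed_procedure d N K F M w x \<longleftrightarrow>
    (\<forall>S. (\<forall>t. S t \<subseteq> {..<N}) \<longrightarrow> fed_run d K F S (M S) (w S) (x S))"

definition round_pmf :: "nat \<Rightarrow> (nat \<Rightarrow> real) \<Rightarrow> nat set pmf"
  where "round_pmf N p =
    map_pmf (\<lambda>b. {i. i < N \<and> b i}) (Pi_pmf {..<N} False (\<lambda>i. bernoulli_pmf (p i)))"

text \<open>
  The vectors known when iterate \<open>T\<close> is chosen have been computed in rounds before \<open>T\<close>, so only the
  participation in rounds \<open>1, \<dots>, T\<close> is drawn; later rounds are filled up with the empty set. The
  support is finite, hence all expectations exist.
\<close>

definition participation_pmf :: "nat \<Rightarrow> (nat \<Rightarrow> real) \<Rightarrow> nat \<Rightarrow> (nat \<Rightarrow> nat set) pmf"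
  where "participation_pmf N p T = Pi_pmf {1..T} {} (\<lambda>_. round_pmf N p)"

end

theory Submission
  imports Defs
begin

text \<open>
  The global objective is a multiple of the chain
  \<open>1/2 * ((x\<^sub>0 - 1)\<^sup>2 + (x\<^sub>1 - x\<^sub>0)\<^sup>2 + \<dots> + (x\<^bsub>d-1\<^esub> - x\<^bsub>d-2\<^esub>)\<^sup>2)\<close>. The odd links \<open>(x\<^sub>l - x\<^bsub>l-1\<^esub>)\<^sup>2\<close> are
  given to a client of minimal participation probability and the even ones to another client.
  A client can discover a new coordinate only across a link of its own, and the next link then
  belongs to the other client; so local steps do not help, and if the rare client has participated
  \<open>B\<close> times, at most \<open>2 B + 1\<close> coordinates are known. At a point with \<open>k\<close> nonzero leading
  coordinates the inner product of the chain's gradient with \<open>(1, 2, \<dots>, k + 1, 0, \<dots>)\<close> is \<open>-1\<close>,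
  so the squared gradient norm is at least \<open>1 / (k + 1)\<^sup>3\<close>. Jensen's inequality for
  \<open>1 / (1 + B)\<^sup>3\<close> concludes the argument.
\<close>

section \<open>Chains of quadratic links\<close>

text \<open>Orthogonality gives \<open>D \<bullet> D \<le> C * (D \<bullet> h)\<close> for the sum
  \<open>D\<close>; Cauchy-Schwarz then lets one factor \<open>norm D\<close> cancel. This supplies
  the Lipschitz constant of a client's gradient.\<close>

lemma norm_sum_orthogonal_le:
  fixes a :: "'i \<Rightarrow> 'a :: real_inner"
  assumes "finite A" "\<And>i j. i \<in> A \<Longrightarrow> j \<in> A \<Longrightarrow> i \<noteq> j \<Longrightarrow> a i \<bullet> a j = 0"
    and "\<And>i. i \<in> A \<Longrightarrow> a i \<bullet> a i \<le> C" "0 \<le> C"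
  shows "norm (\<Sum>i\<in>A. (a i \<bullet> h) *\<^sub>R a i) \<le> C * norm h"
proof -
  define D where "D = (\<Sum>i\<in>A. (a i \<bullet> h) *\<^sub>R a i)"
  have aD: "a i \<bullet> D = (a i \<bullet> h) * (a i \<bullet> a i)" if "i \<in> A" for i
  proof -
    have "a i \<bullet> D = (\<Sum>j\<in>A. (a j \<bullet> h) * (a i \<bullet> a j))"
      by (simp add: D_def inner_sum_right)
    also have "\<dots> = (\<Sum>j\<in>{i}. (a j \<bullet> h) * (a i \<bullet> a j))"
      by (rule sum.mono_neutral_right) (use assms that in auto)
    finally show ?thesis by simp
  qed
  have "D \<bullet> D = (\<Sum>i\<in>A. (a i \<bullet> h) * (a i \<bullet> D))"
    by (subst (1) D_def) (simp add: inner_sum_left)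
  also have "\<dots> \<le> (\<Sum>i\<in>A. C * (a i \<bullet> h)\<^sup>2)"
  proof (rule sum_mono)
    fix i assume "i \<in> A"
    then have "(a i \<bullet> h)\<^sup>2 * (a i \<bullet> a i) \<le> (a i \<bullet> h)\<^sup>2 * C"
      using assms(3) by (intro mult_left_mono) auto
    then show "(a i \<bullet> h) * (a i \<bullet> D) \<le> C * (a i \<bullet> h)\<^sup>2"
      using aD[OF \<open>i \<in> A\<close>] by (simp add: power2_eq_square mult_ac)
  qed
  also have "\<dots> = C * (D \<bullet> h)"
    by (simp add: D_def inner_sum_left sum_distrib_left power2_eq_square)
  also have "\<dots> \<le> C * (norm D * norm h)"
    using assms(4) norm_cauchy_schwarz by (intro mult_left_mono) auto
  finally have "norm D * norm D \<le> norm D * (C * norm h)"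
    by (simp add: power2_norm_eq_inner[symmetric] power2_eq_square mult_ac)
  \<comment> \<open>Settles the case \<open>norm D = 0\<close>, where nothing can be
    cancelled.\<close>
  moreover have "0 \<le> C * norm h" using assms(4) by simp
  ultimately have "norm D \<le> C * norm h"
    by (metis mult_le_cancel_left_pos norm_ge_zero order_le_less)
  then show ?thesis by (simp add: D_def)
qed

lift_definition unit_fvec :: "nat \<Rightarrow> fvec" is "\<lambda>i j. if j = i then 1 else 0" by simp

lemma coord_unit_fvec: "coord (unit_fvec i) j = (if j = i then 1 else 0)"
  by transfer simp

lemma inner_unit_fvec: "unit_fvec i \<bullet> x = coord x i"
proof -
  have "{j. coord (unit_fvec i) j \<noteq> 0} = {i}" by (auto simp: coord_unit_fvec)
  then show ?thesis by (simp add: inner_fvec_def coord_unit_fvec)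
qed

lemma coord_sum: "coord (\<Sum>i\<in>A. f i) j = (\<Sum>i\<in>A. coord (f i) j)"
  by (induction A rule: infinite_finite_induct) auto

definition link :: "nat \<Rightarrow> fvec"
  where "link l = unit_fvec l - (if l = 0 then 0 else unit_fvec (l - 1))"

text \<open>As if a coordinate of fixed value 1 preceded coordinate 0: link 0 alone pulls away from
  the origin.\<close>

definition link_target :: "nat \<Rightarrow> real"
  where "link_target l = (if l = 0 then 1 else 0)"

text \<open>The link set is a parameter: a client holds links of one parity or none, the global
  objective all links below \<open>d\<close>. The latter is Nesterov's worst-case quadratic with a
  free end.\<close>

definition chain :: "real \<Rightarrow> nat set \<Rightarrow> fvec \<Rightarrow> real"
  where "chain c A x = c / 2 * (\<Sum>l\<in>A. (link l \<bullet> x - link_target l)\<^sup>2)"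

definition chain_grad :: "real \<Rightarrow> nat set \<Rightarrow> fvec \<Rightarrow> fvec"
  where "chain_grad c A x = c *\<^sub>R (\<Sum>l\<in>A. (link l \<bullet> x - link_target l) *\<^sub>R link l)"

lemma inner_link: "link l \<bullet> x = coord x l - (if l = 0 then 0 else coord x (l - 1))"
  by (simp add: link_def inner_diff_left inner_unit_fvec)

lemma coord_link:
  "coord (link l) i = (if i = l then 1 else if Suc i = l then -1 else 0)"
  by (auto simp: link_def coord_unit_fvec)

lemma link_in_Rn: "l < m \<Longrightarrow> link l \<in> Rn m"
  by (auto simp: Rn_def coord_link)

lemma Rn_mono: "m \<le> n \<Longrightarrow> Rn m \<subseteq> Rn n"
  by (auto simp: Rn_def)

lemma chain_grad_in_Rn: "A \<subseteq> {..<d} \<Longrightarrow> chain_grad c A x \<in> Rn d"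
  unfolding chain_grad_def
  by (intro subspace_scale subspace_sum subspace_Rn link_in_Rn) auto

lemma has_gradient_chain:
  assumes "A \<subseteq> {..<d}"
  shows "has_gradient d (chain c A) x (chain_grad c A x)"
proof -
  have "((\<lambda>x. chain c A x) has_derivative (\<lambda>h. chain_grad c A x \<bullet> h)) (at x within Rn d)"
    unfolding chain_def chain_grad_def
    by (auto intro!: derivative_eq_intros ext sum.cong
        simp: inner_sum_left inner_diff_left sum_distrib_left field_simps)
  then show ?thesis
    using chain_grad_in_Rn[OF assms] by (simp add: has_gradient_def)
qed

lemma grad_chain:
  assumes "A \<subseteq> {..<d}" "x \<in> Rn d"
  shows "grad d (chain c A) x = chain_grad c A x"
  unfolding grad_def
  using has_gradient_chain[OF assms(1)] has_gradient_unique[OF assms(2)] by blast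

text \<open>Non-adjacent links are pairwise orthogonal with squared norm at most 2, so the constant
  is \<open>2 * c\<close> in every dimension.\<close>

lemma smooth_chain:
  assumes "A \<subseteq> {..<d}" "\<And>l. l \<in> A \<Longrightarrow> Suc l \<notin> A" "0 \<le> c"
  shows "smooth_fun d (2 * c) (chain c A)"
proof -
  have orth: "link i \<bullet> link j = 0" if "i \<in> A" "j \<in> A" "i \<noteq> j" for i j
  proof -
    have "Suc i \<noteq> j" "Suc j \<noteq> i" using assms(2) that by auto
    then show ?thesis
      using that by (auto simp: inner_link coord_link)
  qed
  have le2: "link i \<bullet> link i \<le> 2" for i
    by (auto simp: inner_link coord_link)
  have "finite A" using assms(1) finite_subset by blast
  have "norm (chain_grad c A u - chain_grad c A v) \<le> 2 * c * norm (u - v)" for u v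
  proof -
    have "chain_grad c A u - chain_grad c A v = c *\<^sub>R (\<Sum>l\<in>A. (link l \<bullet> (u - v)) *\<^sub>R link l)"
      by (simp add: chain_grad_def scaleR_diff_right[symmetric] sum_subtractf[symmetric]
          scaleR_diff_left[symmetric] inner_diff_right)
    then show ?thesis
      using norm_sum_orthogonal_le[of A link 2 "u - v", OF \<open>finite A\<close> orth le2] assms(3)
      by (simp add: mult_left_mono mult_ac)
  qed
  then show ?thesis
    using has_gradient_chain[OF assms(1)] grad_chain[OF assms(1)]
    unfolding smooth_fun_def by (metis (no_types, lifting))
qed

text \<open>The only link that leads out of \<open>Rn m\<close> is the one with index \<open>m\<close>.\<close>

lemma chain_grad_invariant:
  assumes "m \<notin> A" "x \<in> Rn m"
  shows "chain_grad c A x \<in> Rn m"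
  unfolding chain_grad_def
proof (rule subspace_scale[OF subspace_Rn], rule subspace_sum[OF subspace_Rn])
  fix l assume "l \<in> A"
  then consider "l < m" | "m < l" using assms(1) by (metis linorder_neqE_nat)
  then show "(link l \<bullet> x - link_target l) *\<^sub>R link l \<in> Rn m"
  proof cases
    case 1
    then show ?thesis by (intro subspace_scale subspace_Rn link_in_Rn)
  next
    case 2
    \<comment> \<open>Both \<open>l\<close> and \<open>l - 1\<close> are at least \<open>m\<close>,
      where \<open>x\<close> vanishes, and \<open>l > 0\<close> makes the target 0.\<close>
    then have "link l \<bullet> x - link_target l = 0"
      using assms(2) by (auto simp: inner_link link_target_def Rn_def)
    then show ?thesis by (simp add: subspace_0 subspace_Rn)
  qed
qed

text \<open>Every link up to \<open>k\<close> has increment 1 on \<open>v\<close>, so pairing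
  \<open>v\<close> with the gradient adds up the residuals, which telescope. Cauchy-Schwarz and a
  termwise bound on \<open>v \<bullet> v\<close> give the cube.\<close>

lemma norm_chain_grad_ge:
  assumes "x \<in> Rn k" "k < d" "0 \<le> c"
  shows "c\<^sup>2 / (real k + 1) ^ 3 \<le> (norm (chain_grad c {..<d} x))\<^sup>2"
proof -
  define v where "v = (\<Sum>i\<le>k. real (Suc i) *\<^sub>R unit_fvec i)"
  have cv: "coord v j = (if j \<le> k then real (Suc j) else 0)" for j
    by (simp add: v_def coord_sum coord_unit_fvec if_distrib[of "\<lambda>z. _ * z"] cong: if_cong)
  have "v \<in> Rn (Suc k)" by (auto simp: Rn_def cv)
  then have "v \<bullet> v = (\<Sum>i<Suc k. (real (Suc i))\<^sup>2)"
    by (simp add: inner_Rn cv power2_eq_square)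
  also have "\<dots> \<le> (\<Sum>i<Suc k. (real k + 1)\<^sup>2)"
    by (intro sum_mono power_mono) auto
  also have "\<dots> = (real k + 1) ^ 3"
    by (simp add: power2_eq_square power3_eq_cube algebra_simps)
  finally have vv: "(norm v)\<^sup>2 \<le> (real k + 1) ^ 3"
    by (simp add: power2_norm_eq_inner)
  have tel: "(\<Sum>l<Suc n. link l \<bullet> x - link_target l) = coord x n - 1" for n
    by (induction n) (auto simp: inner_link link_target_def)
  \<comment> \<open>Link \<open>k + 1\<close>, where \<open>v\<close> drops to 0, has residual 0,
    since \<open>x\<close> vanishes at \<open>k\<close> and \<open>k + 1\<close>.\<close>
  have "(\<Sum>l<d. (link l \<bullet> x - link_target l) * (link l \<bullet> v))
      = (\<Sum>l<Suc k. (link l \<bullet> x - link_target l) * (link l \<bullet> v))"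
    by (rule sum.mono_neutral_right)
       (use assms in \<open>auto simp: inner_link link_target_def cv Rn_def\<close>)
  also have "\<dots> = (\<Sum>l<Suc k. link l \<bullet> x - link_target l)"
    by (rule sum.cong) (auto simp: inner_link cv)
  also have "\<dots> = -1"
    unfolding tel using assms(1) by (simp add: Rn_def)
  finally have "chain_grad c {..<d} x \<bullet> v = - c"
    by (simp add: chain_grad_def inner_sum_left)
  then have "c \<le> norm (chain_grad c {..<d} x) * norm v"
    using Cauchy_Schwarz_ineq2[of "chain_grad c {..<d} x" v] assms(3) by simp
  then have "c\<^sup>2 \<le> (norm (chain_grad c {..<d} x))\<^sup>2 * (norm v)\<^sup>2"
    using assms(3) power_mono[of c _ 2] by (simp add: power_mult_distrib[symmetric])
  also have "\<dots> \<le> (norm (chain_grad c {..<d} x))\<^sup>2 * (real k + 1) ^ 3"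
    using vv by (intro mult_left_mono) auto
  finally show ?thesis
    by (simp add: field_simps)
qed

text \<open>The all-ones vector satisfies every link, so this sum of squares attains 0.\<close>

lemma chain_minimizer:
  assumes "0 \<le> c"
  shows "\<exists>w. is_minimizer d (chain c {..<d}) w \<and> chain c {..<d} w = 0"
proof -
  obtain w where w: "w \<in> Rn d" "\<And>i. i < d \<Longrightarrow> coord w i = 1"
    using coord_Rn_surj[of d "\<lambda>_. 1"] by auto
  have "chain c {..<d} w = 0"
    using w(2) by (auto simp: chain_def inner_link link_target_def intro!: sum.neutral)
  moreover have "0 \<le> chain c {..<d} v" for v
    using assms by (simp add: chain_def sum_nonneg)
  ultimately show ?thesis
    using w(1) by (auto simp: is_minimizer_def)
qed

lemma chain_zero:
  assumes "0 < d"
  shows "chain c {..<d} 0 = c / 2"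
proof -
  have "(\<Sum>l<d. (link_target l)\<^sup>2) = (\<Sum>l\<in>{0}. (link_target l)\<^sup>2)"
    by (rule sum.mono_neutral_right) (use assms in \<open>auto simp: link_target_def\<close>)
  then show ?thesis by (simp add: chain_def link_target_def)
qed

text \<open>Each link has exactly one owner, so summing over clients counts it once and averaging
  only rescales the constant.\<close>

lemma global_obj_chain:
  assumes "owner ` {..<d} \<subseteq> {..<N}"
  shows "global_obj N (\<lambda>i. chain c {l. l < d \<and> owner l = i}) = chain (c / real N) {..<d}"
proof
  fix x
  show "global_obj N (\<lambda>i. chain c {l. l < d \<and> owner l = i}) x = chain (c / real N) {..<d} x"
    using sum.group[of "{..<d}" "{..<N}" owner "\<lambda>l. (link l \<bullet> x - link_target l)\<^sup>2"] assms
    by (simp add: global_obj_def chain_def sum_distrib_left[symmetric]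
        sum_divide_distrib[symmetric] mult.commute)
qed

section \<open>The known subspace\<close>

text \<open>Each participant may have its own invariant \<open>Rn m\<close>: the owner of the next
  link needs one more coordinate than the others. The bound holds for any number \<open>K\<close> of
  local steps.\<close>

lemma fed_run_step:
  assumes run: "fed_run d K F S M w x" and "1 \<le> t" and M: "M t \<subseteq> Rn k"
    and inv: "\<And>i. i \<in> S t \<Longrightarrow>
      \<exists>m. k \<le> m \<and> m \<le> k' \<and> (\<forall>y\<in>Rn m. grad d (F i) y \<in> Rn m)"
    and "k \<le> k'"
  shows "M (Suc t) \<subseteq> Rn k'"
proof -
  have known: "grad d (F i) (x t i j) \<in> Rn k'" if "i \<in> S t" "j < K" for i j
  proof -
    obtain m where m: "k \<le> m" "m \<le> k'" "\<And>y. y \<in> Rn m \<Longrightarrow> grad d (F i) y \<in> Rn m"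
      using inv \<open>i \<in> S t\<close> by blast
    \<comment> \<open>Strong induction over local steps: a query point is spanned by known vectors
      and earlier gradients of the same client.\<close>
    have "x t i j \<in> Rn m" if "j < K" for j
      using that
    proof (induction j rule: less_induct)
      case (less j)
      have "x t i j \<in> span (M t \<union> {grad d (F i) (x t i j') | j'. j' < j})"
        using run \<open>1 \<le> t\<close> \<open>i \<in> S t\<close> less.prems unfolding fed_run_def by blast
      moreover have "M t \<union> {grad d (F i) (x t i j') | j'. j' < j} \<subseteq> Rn m"
        using M Rn_mono[OF m(1)] m(3) less by auto
      ultimately show ?case
        using span_minimal[OF _ subspace_Rn] by blast
    qed
    then show ?thesis using m Rn_mono that(2) by blast
  qed
  have "M (Suc t) = span (M t \<union> {grad d (F i) (x t i k) | i k. i \<in> S t \<and> k < K})"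
    using run \<open>1 \<le> t\<close> unfolding fed_run_def by blast
  also have "\<dots> \<subseteq> Rn k'"
    using M Rn_mono[OF \<open>k \<le> k'\<close>] known by (intro span_minimal subspace_Rn) auto
  finally show ?thesis .
qed

text \<open>A round reveals at most one coordinate, hence \<open>k < t\<close>. Passing an odd link
  needs client \<open>a\<close>, hence two coordinates per participation of \<open>a\<close>; the
  \<open>+ 1\<close> is link 0, which belongs to \<open>b\<close>.\<close>

lemma fed_run_known:
  assumes run: "fed_run d K (\<lambda>i. chain c {l. l < d \<and> (if odd l then a else b) = i}) S M w x"
    and "a \<noteq> b" "1 \<le> t" "t \<le> d"
  shows "\<exists>k. k < t \<and> k \<le> 2 * card {s \<in> {1..<t}. a \<in> S s} + 1 \<and> M t \<subseteq> Rn k"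
  using assms(3,4)
proof (induction t rule: dec_induct)
  case base
  then show ?case
    using run by (auto simp: fed_run_def subspace_0 subspace_Rn intro!: exI[of _ 0])
next
  case (step t)
  define F where "F = (\<lambda>i. chain c {l. l < d \<and> (if odd l then a else b) = i})"
  note run' = run[folded F_def]
  let ?B = "\<lambda>t. card {s \<in> {1..<t}. a \<in> S s}"
  obtain k where k: "k < t" "k \<le> 2 * ?B t + 1" "M t \<subseteq> Rn k"
    using step by auto
  have inv: "grad d (F i) y \<in> Rn m"
    if "m \<le> d" "(if odd m then a else b) \<noteq> i" "y \<in> Rn m" for i m y
  proof -
    have "y \<in> Rn d" using that Rn_mono by blast
    moreover have "{l. l < d \<and> (if odd l then a else b) = i} \<subseteq> {..<d}" by auto
    ultimately have "grad d (F i) y = chain_grad c {l. l < d \<and> (if odd l then a else b) = i} y"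
      unfolding F_def by (intro grad_chain)
    then show ?thesis using chain_grad_invariant that by (auto simp: F_def)
  qed
  have Bsuc: "?B (Suc t) = (if a \<in> S t then Suc (?B t) else ?B t)"
  proof -
    have "{s \<in> {1..<Suc t}. a \<in> S s} =
        (if a \<in> S t then insert t {s \<in> {1..<t}. a \<in> S s} else {s \<in> {1..<t}. a \<in> S s})"
      using step.hyps by (auto simp: less_Suc_eq)
    then show ?thesis by simp
  qed
  show ?case
  \<comment> \<open>Here the owner of link \<open>k\<close> is absent, so nothing new is
    found.\<close>
  proof (cases "odd k \<and> a \<notin> S t")
    case True
    have "M (Suc t) \<subseteq> Rn k"
    proof (rule fed_run_step[OF run' step.hyps(1) k(3)])
      fix i assume "i \<in> S t"
      then show "\<exists>m\<ge>k. m \<le> k \<and> (\<forall>y\<in>Rn m. grad d (F i) y \<in> Rn m)"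
        using True inv[of k i] k(1) step.prems by (intro exI[of _ k]) auto
    qed simp
    then show ?thesis using k Bsuc True by (intro exI[of _ k]) auto
  next
    case False
    have "M (Suc t) \<subseteq> Rn (Suc k)"
    proof (rule fed_run_step[OF run' step.hyps(1) k(3)])
      fix i assume "i \<in> S t"
      show "\<exists>m\<ge>k. m \<le> Suc k \<and> (\<forall>y\<in>Rn m. grad d (F i) y \<in> Rn m)"
      \<comment> \<open>The owner of link \<open>k\<close> does not own link \<open>k + 1\<close>,
        so all its local steps stay in \<open>Rn (Suc k)\<close>; any other client stays in
        \<open>Rn k\<close>.\<close>
      proof (cases "(if odd k then a else b) = i")
        case True
        then show ?thesis
          using \<open>a \<noteq> b\<close> inv[of "Suc k" i] k(1) step.prems by (intro exI[of _ "Suc k"]) auto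
      next
        case False
        then show ?thesis
          using inv[of k i] k(1) step.prems by (intro exI[of _ k]) auto
      qed
    qed simp
    moreover have "Suc k \<le> 2 * ?B (Suc t) + 1"
    proof (cases "a \<in> S t")
      case True
      then show ?thesis using k(2) Bsuc by simp
    next
      case F: False
      then have "even k" using False by simp
      \<comment> \<open>By parity the bound on \<open>k\<close> is strict, which leaves room for one
        coordinate without \<open>a\<close>.\<close>
      then have "k \<noteq> 2 * ?B t + 1" by auto
      then show ?thesis using F k(2) Bsuc by simp
    qed
    ultimately show ?thesis using k(1) by (intro exI[of _ "Suc k"]) auto
  qed
qed

section \<open>Participation counts\<close>

lemma set_round_pmf: "set_pmf (round_pmf N p) \<subseteq> Pow {..<N}"
  by (auto simp: round_pmf_def)

lemma finite_set_participation_pmf: "finite (set_pmf (participation_pmf N p T))"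
  unfolding participation_pmf_def
  by (subst set_Pi_pmf) (auto intro!: finite_PiE_dflt finite_subset[OF set_round_pmf])

text \<open>Rounds outside \<open>{1..T}\<close> carry the default \<open>{}\<close>, so the bound
  holds for every \<open>t\<close>, as \<open>fed_procedure\<close> demands.\<close>

lemma participation_pmf_subset:
  assumes "S \<in> set_pmf (participation_pmf N p T)"
  shows "S t \<subseteq> {..<N}"
  using assms set_round_pmf[of N p] unfolding participation_pmf_def
  by (cases "t \<in> {1..T}") (auto simp: set_Pi_pmf PiE_dflt_def; blast)+

text \<open>Projecting the product over rounds to \<open>s\<close> and the product over clients to
  \<open>i\<close> leaves a Bernoulli variable.\<close>

lemma expectation_participates:
  assumes "i < N" "0 \<le> p i" "p i \<le> 1" "s \<in> {1..T}"
  shows "measure_pmf.expectation (participation_pmf N p T) (\<lambda>S. of_bool (i \<in> S s)) = p i"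
proof -
  have "measure_pmf.expectation (participation_pmf N p T) (\<lambda>S. of_bool (i \<in> S s) :: real)
      = measure_pmf.expectation (map_pmf (\<lambda>S. S s) (participation_pmf N p T)) (\<lambda>A. of_bool (i \<in> A))"
    by simp
  also have "map_pmf (\<lambda>S. S s) (participation_pmf N p T) = round_pmf N p"
    unfolding participation_pmf_def using assms(4) by (subst Pi_pmf_component) auto
  also have "measure_pmf.expectation (round_pmf N p) (\<lambda>A. of_bool (i \<in> A) :: real)
      = measure_pmf.expectation
          (map_pmf (\<lambda>b. b i) (Pi_pmf {..<N} False (\<lambda>i. bernoulli_pmf (p i)))) of_bool"
    using assms(1) by (simp add: round_pmf_def)
  also have "map_pmf (\<lambda>b. b i) (Pi_pmf {..<N} False (\<lambda>i. bernoulli_pmf (p i))) = bernoulli_pmf (p i)"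
    using assms(1) by (subst Pi_pmf_component) auto
  also have "measure_pmf.expectation (bernoulli_pmf (p i)) of_bool = p i"
    using assms by simp
  finally show ?thesis .
qed

text \<open>The left side is the tangent at \<open>m\<close> of the convex function
  \<open>1 / y ^ 3\<close>. Clearing denominators leaves a quartic with double root
  \<open>y = m\<close>.\<close>

lemma inverse_cube_ge_tangent:
  fixes y m :: real
  assumes "0 < y" "0 < m"
  shows "1 / m ^ 3 - 3 / m ^ 4 * (y - m) \<le> 1 / y ^ 3"
proof -
  have "0 \<le> (y - m)\<^sup>2 * (3 * y\<^sup>2 + 2 * y * m + m\<^sup>2)"
    using assms by simp
  also have "\<dots> = m ^ 4 - y ^ 3 * (4 * m - 3 * y)"
    by algebra
  finally have "y ^ 3 * (4 * m - 3 * y) \<le> m ^ 4" by simp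
  then have "(4 * m - 3 * y) / m ^ 4 \<le> 1 / y ^ 3"
    using assms by (simp add: field_simps)
  moreover have "(4 * m - 3 * y) / m ^ 4 = 1 / m ^ 3 - 3 / m ^ 4 * (y - m)"
    using assms by (simp add: field_simps eval_nat_numeral)
  ultimately show ?thesis by simp
qed

text \<open>The factor 4 is sharp at \<open>z = 1\<close>, the double root of the
  difference.\<close>

lemma one_add_cube_le:
  fixes z :: real
  assumes "0 \<le> z"
  shows "(1 + z) ^ 3 \<le> 4 * (z ^ 3 + 1)"
proof -
  have "4 * (z ^ 3 + 1) - (1 + z) ^ 3 = 3 * (1 + z) * (z - 1)\<^sup>2"
    by algebra
  moreover have "0 \<le> 3 * (1 + z) * (z - 1)\<^sup>2" using assms by simp
  ultimately show ?thesis by linarith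
qed

text \<open>Jensen's inequality via the tangent at the mean \<open>m\<close> of one plus the
  participation count in the \<open>t - 1\<close> rounds before \<open>t\<close>. The loss of 4
  comes from \<open>one_add_cube_le\<close>.\<close>

lemma expectation_ge_count:
  fixes f :: "(nat \<Rightarrow> nat set) \<Rightarrow> real"
  assumes "i < N" "0 \<le> p i" "p i \<le> 1" "1 \<le> t" "t \<le> T" "0 \<le> C"
    and f: "\<And>S. S \<in> set_pmf (participation_pmf N p T) \<Longrightarrow>
      C / (1 + real (card {s \<in> {1..<t}. i \<in> S s})) ^ 3 \<le> f S"
  shows "C / 4 / (p i ^ 3 * real T ^ 3 + 1)
    \<le> measure_pmf.expectation (participation_pmf N p T) f"
proof -
  let ?P = "participation_pmf N p T"
  define B where "B S = (\<Sum>s\<in>{1..<t}. of_bool (i \<in> S s) :: real)" for S :: "nat \<Rightarrow> nat set"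
  define m where "m = 1 + real (t - 1) * p i"
  have int: "integrable (measure_pmf ?P) g" for g :: "(nat \<Rightarrow> nat set) \<Rightarrow> real"
    by (rule integrable_measure_pmf_finite[OF finite_set_participation_pmf])
  have m: "1 \<le> m" "m \<le> 1 + p i * real T"
    using assms mult_right_mono[of "real (t - 1)" "real T" "p i"]
    by (auto simp: m_def mult.commute)
  have card: "real (card {s \<in> {1..<t}. i \<in> S s}) = B S" for S
    by (simp add: B_def sum.If_cases of_bool_def Int_def)
  have B0: "0 \<le> B S" for S by (simp add: B_def sum_nonneg)
  have "measure_pmf.expectation ?P B = (\<Sum>s\<in>{1..<t}. measure_pmf.expectation ?P (\<lambda>S. of_bool (i \<in> S s)))"
    unfolding B_def by (rule Bochner_Integration.integral_sum) (rule int)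
  also have "\<dots> = (\<Sum>s\<in>{1..<t}. p i)"
    by (rule sum.cong) (use assms in \<open>auto intro!: expectation_participates\<close>)
  finally have EB: "measure_pmf.expectation ?P B = m - 1"
    by (simp add: m_def)
  have "measure_pmf.expectation ?P (\<lambda>S. C * (1 / m ^ 3 - 3 / m ^ 4 * (1 + B S - m)))
      = C * (1 / m ^ 3 - 3 / m ^ 4 * (1 + measure_pmf.expectation ?P B - m))"
    by (simp add: int)
  \<comment> \<open>The tangent point is the mean, so the linear term vanishes.\<close>
  also have "\<dots> = C / m ^ 3" by (simp add: EB)
  finally have E: "measure_pmf.expectation ?P (\<lambda>S. C * (1 / m ^ 3 - 3 / m ^ 4 * (1 + B S - m)))
      = C / m ^ 3" .
  have "m ^ 3 \<le> (1 + p i * real T) ^ 3"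
    using m by (intro power_mono) auto
  also have "\<dots> \<le> 4 * (p i ^ 3 * real T ^ 3 + 1)"
    using one_add_cube_le[of "p i * real T"] assms
    by (simp add: power_mult_distrib)
  finally have "C / (4 * (p i ^ 3 * real T ^ 3 + 1)) \<le> C / m ^ 3"
    using assms(6) m(1) by (intro frac_le) auto
  also have "\<dots> \<le> measure_pmf.expectation ?P f"
    unfolding E[symmetric]
  proof (rule integral_mono_AE[OF int int], unfold AE_measure_pmf_iff, rule ballI)
    fix S assume S: "S \<in> set_pmf ?P"
    have "C * (1 / m ^ 3 - 3 / m ^ 4 * (1 + B S - m)) \<le> C * (1 / (1 + B S) ^ 3)"
      using inverse_cube_ge_tangent[of "1 + B S" m] B0[of S] m(1) assms(6)
      by (intro mult_left_mono) auto
    also have "\<dots> \<le> f S" using f[OF S, unfolded card] by simp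
    finally show "C * (1 / m ^ 3 - 3 / m ^ 4 * (1 + B S - m)) \<le> f S" .
  qed
  finally show ?thesis by simp
qed

section \<open>The lower bound\<close>

theorem theorem4:
  fixes N :: nat and L :: real
  assumes "N \<ge> 2" and "L > 0"
  shows "\<exists>c>0. \<forall>(p :: nat \<Rightarrow> real) (T :: nat) (d :: nat).
    (\<forall>i<N. 0 < p i \<and> p i \<le> 1) \<longrightarrow> T \<ge> 1 \<longrightarrow> real T \<le> (real d - 1) / 2 \<longrightarrow>
    (\<exists>(F :: nat \<Rightarrow> fvec \<Rightarrow> real) wmin.
       (\<forall>i<N. smooth_fun d L (F i)) \<and>
       is_minimizer d (global_obj N F) wmin \<and>
       global_obj N F wmin < global_obj N F 0 \<and>
       (\<forall>K M w x. K \<ge> 1 \<longrightarrow> fed_procedure d N K F M w x \<longrightarrow>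
          (MIN t\<in>{1..T}. measure_pmf.expectation (participation_pmf N p T)
             (\<lambda>S. (norm (grad d (global_obj N F) (w S t)))\<^sup>2))
          \<ge> c * (global_obj N F 0 - global_obj N F wmin)
              / ((Min (p ` {..<N})) ^ 3 * real T ^ 3 + 1)))"
\<comment> \<open>With \<open>c = L / (2 * N)\<close> the initial gap is \<open>c / 2\<close>, and
  this constant times the gap is \<open>c\<^sup>2 / 32\<close>. Here 32 is 8 from
  \<open>(2 * (1 + B)) ^ 3\<close> times 4 from \<open>expectation_ge_count\<close>.\<close>
proof (intro exI[of _ "L / (32 * real N)"] conjI allI impI)
  show "0 < L / (32 * real N)" using assms by simp
  fix p :: "nat \<Rightarrow> real" and T d :: nat
  assume p: "\<forall>i<N. 0 < p i \<and> p i \<le> 1" and T: "T \<ge> 1" "real T \<le> (real d - 1) / 2"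
  have "real T < real d" using T by (simp add: field_simps)
  then have d: "T < d" "0 < d" by simp_all
  have "Min (p ` {..<N}) \<in> p ` {..<N}"
    using assms(1) by (intro Min_in) (auto simp: lessThan_empty_iff)
  then obtain a where a: "a < N" "Min (p ` {..<N}) = p a" by auto
  \<comment> \<open>Any second client would do; clients other than \<open>a\<close> and
    \<open>b\<close> own no link and have objective 0.\<close>
  define b where "b = (if a = 0 then 1 else 0 :: nat)"
  have b: "b < N" "a \<noteq> b" using assms(1) by (auto simp: b_def)
  \<comment> \<open>The factor \<open>L / 2\<close> offsets the doubling in
    \<open>smooth_chain\<close>.\<close>
  define F where "F = (\<lambda>i. chain (L / 2) {l. l < d \<and> (if odd l then a else b) = i})"
  define c where "c = L / 2 / real N"
  have c: "0 < c" using assms by (simp add: c_def)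
  have G: "global_obj N F = chain c {..<d}"
    unfolding F_def c_def by (rule global_obj_chain) (use a b in auto)
  obtain wmin where wmin: "is_minimizer d (chain c {..<d}) wmin" "chain c {..<d} wmin = 0"
    using chain_minimizer c by (metis less_imp_le)
  have smooth: "smooth_fun d L (F i)" for i
  proof -
    have "smooth_fun d (2 * (L / 2)) (F i)"
      unfolding F_def by (rule smooth_chain) (use assms(2) b(2) in auto)
    then show ?thesis by simp
  qed
  have bound: "L / (32 * real N) * (global_obj N F 0 - global_obj N F wmin)
        / ((Min (p ` {..<N})) ^ 3 * real T ^ 3 + 1)
      \<le> (MIN t\<in>{1..T}. measure_pmf.expectation (participation_pmf N p T)
             (\<lambda>S. (norm (grad d (global_obj N F) (w S t)))\<^sup>2))"
    if proc: "fed_procedure d N K F M w x" for K M w x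
  proof -
    have "L / (32 * real N) * (global_obj N F 0 - global_obj N F wmin)
        / ((Min (p ` {..<N})) ^ 3 * real T ^ 3 + 1)
      \<le> measure_pmf.expectation (participation_pmf N p T)
             (\<lambda>S. (norm (grad d (global_obj N F) (w S t)))\<^sup>2)" if t: "t \<in> {1..T}" for t
    proof -
      have "c\<^sup>2 / 8 / 4 / (p a ^ 3 * real T ^ 3 + 1)
        \<le> measure_pmf.expectation (participation_pmf N p T)
             (\<lambda>S. (norm (grad d (global_obj N F) (w S t)))\<^sup>2)"
      proof (rule expectation_ge_count)
        fix S assume "S \<in> set_pmf (participation_pmf N p T)"
        then have run: "fed_run d K F S (M S) (w S) (x S)"
          using proc participation_pmf_subset unfolding fed_procedure_def by blast
        let ?B = "card {s \<in> {1..<t}. a \<in> S s}"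
        obtain k where k: "k < t" "k \<le> 2 * ?B + 1" "M S t \<subseteq> Rn k"
          using fed_run_known[OF run[unfolded F_def] b(2), of t] t d by auto
        have w: "w S t \<in> Rn k"
          using run t k(3) by (auto simp: fed_run_def)
        then have "w S t \<in> Rn d" using Rn_mono[of k d] k(1) t d by auto
        then have grad: "grad d (global_obj N F) (w S t) = chain_grad c {..<d} (w S t)"
          unfolding G by (intro grad_chain) auto
        have "real k \<le> real (2 * ?B + 1)" using k(2) by (simp only: of_nat_le_iff)
        then have "real k + 1 \<le> 2 * (1 + real ?B)" by simp
        then have "(real k + 1) ^ 3 \<le> (2 * (1 + real ?B)) ^ 3"
          by (intro power_mono) auto
        then have "c\<^sup>2 / (2 * (1 + real ?B)) ^ 3 \<le> c\<^sup>2 / (real k + 1) ^ 3"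
          by (intro divide_left_mono) auto
        also have "\<dots> \<le> (norm (chain_grad c {..<d} (w S t)))\<^sup>2"
          using w k(1) t d c by (intro norm_chain_grad_ge) auto
        finally show "c\<^sup>2 / 8 / (1 + real ?B) ^ 3 \<le> (norm (grad d (global_obj N F) (w S t)))\<^sup>2"
          unfolding grad power_mult_distrib by simp
      qed (use a p t in \<open>auto intro: less_imp_le\<close>)
      moreover have "L / (32 * real N) * (global_obj N F 0 - global_obj N F wmin) = c\<^sup>2 / 8 / 4"
        using chain_zero[OF d(2), of c] wmin(2)
        by (simp add: G c_def power2_eq_square)
      ultimately show ?thesis by (simp only: a(2))
    qed
    then show ?thesis using T(1) by (subst Min_ge_iff) auto
  qed
  show "\<exists>F wmin. (\<forall>i<N. smooth_fun d L (F i)) \<and>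
       is_minimizer d (global_obj N F) wmin \<and>
       global_obj N F wmin < global_obj N F 0 \<and>
       (\<forall>K M w x. K \<ge> 1 \<longrightarrow> fed_procedure d N K F M w x \<longrightarrow>
          (MIN t\<in>{1..T}. measure_pmf.expectation (participation_pmf N p T)
             (\<lambda>S. (norm (grad d (global_obj N F) (w S t)))\<^sup>2))
          \<ge> L / (32 * real N) * (global_obj N F 0 - global_obj N F wmin)
              / ((Min (p ` {..<N})) ^ 3 * real T ^ 3 + 1))"
  proof (intro exI[of _ F] exI[of _ wmin] conjI allI impI)
    \<comment> \<open>The gap is positive, so the lower bound is not trivially 0.\<close>
    show "global_obj N F wmin < global_obj N F 0"
      using chain_zero[OF d(2), of c] wmin(2) c by (simp add: G)
  qed (use smooth wmin(1) bound in \<open>simp_all add: G\<close>)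
qed

end
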